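(* Let $q \geq 4$ be a prime power and $n = q^{2}-1$. Then there exists a convolutional code with parameters $(n,\; n-2q,\; 2q-4;\; 1,\; d_{free} \geq 2q+1)_{q}$.
   Context: A matrix $G(D)=(g_{ij})\in \mathbb{F}_q[D]^{k\times n}$ is called basic if it has a polynomial right inverse. Its $i$-th row degree is $\gamma_i=\max_{1\le j\le n}\deg g_{ij}$ and its overall constraint length is $\gamma=\sum_{i=1}^k\gamma_i$. A basic generator matrix of a code is called reduced if its overall constraint length is the smallest among all basic generator matrices of that code. A convolutional code with parameters $(n,k,\gamma;\mu,d_f)_q$ is a submodule $C=\{\mathbf{u}(D)G(D) : \mathbf{u}(D)\in\mathbb{F}_q[D]^k\}$ of $\mathbb{F}_q[D]^n$ generated by a reduced basic matrix $G(D)\in\mathbb{F}_q[D]^{k\times n}$, where $n$ is the length, $k$ the dimension, $\gamma=\sum_{i=1}^k\gamma_i$ the degree, $\mu=\max_{1\le i\le k}\gamma_i$ the memory, and $d_f=d_{free}=\min\{\mathrm{wt}(\mathbf{v}(D)) : \mathbf{v}(D)\in C,\ \mathbf{v}(D)\neq 0\}$ the free distance; here $\mathrm{wt}(\mathbf{v}(D))$ is the total number of nonzero coefficients over all $n$ polynomial components of $\mathbf{v}(D)$. Writing "$d_{free}\ge a$" in the last slot means the free distance is at least $a$. *)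

theory Defs
  imports
    "HOL-Library.Cardinality"
    "HOL-Computational_Algebra.Polynomial"
    "HOL-Number_Theory.Prime_Powers"
    "Jordan_Normal_Form.Matrix"
begin

definition basic_matrix :: "'a::field poly mat \<Rightarrow> bool" where
  "basic_matrix G \<longleftrightarrow>
     (\<exists>H \<in> carrier_mat (dim_col G) (dim_row G). G * H = 1\<^sub>m (dim_row G))"

(* The library has degree 0 = 0 rather than minus infinity. For rows of a basic matrix this makes
   no difference: such a row has a nonzero entry. *)
definition row_degree :: "'a::field poly mat \<Rightarrow> nat \<Rightarrow> nat" where
  "row_degree G i = Max ((\<lambda>j. degree (G $$ (i, j))) ` {..<dim_col G})"

definition overall_constraint_length :: "'a::field poly mat \<Rightarrow> nat" where
  "overall_constraint_length G = (\<Sum>i<dim_row G. row_degree G i)"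

definition memory :: "'a::field poly mat \<Rightarrow> nat" where
  "memory G = Max (row_degree G ` {..<dim_row G})"

(* Codewords are row vectors u G. Vectors of the matrix library are columns, hence the
   transpose. *)
definition code_of :: "'a::field poly mat \<Rightarrow> 'a poly vec set" where
  "code_of G = {transpose_mat G *\<^sub>v u | u. u \<in> carrier_vec (dim_row G)}"

definition basic_generator_matrix :: "nat \<Rightarrow> 'a::field poly vec set \<Rightarrow> 'a poly mat \<Rightarrow> bool" where
  "basic_generator_matrix n C G \<longleftrightarrow> dim_col G = n \<and> basic_matrix G \<and> code_of G = C"

definition reduced_basic_generator_matrix ::
    "nat \<Rightarrow> 'a::field poly vec set \<Rightarrow> 'a poly mat \<Rightarrow> bool" where
  "reduced_basic_generator_matrix n C G \<longleftrightarrow>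
     basic_generator_matrix n C G \<and>
     (\<forall>G'. basic_generator_matrix n C G' \<longrightarrow>
        overall_constraint_length G \<le> overall_constraint_length G')"

definition weight :: "'a::field poly vec \<Rightarrow> nat" where
  "weight v = (\<Sum>i<dim_vec v. card {m. coeff (v $ i) m \<noteq> 0})"

(* Inf of a nonempty set of naturals is its minimum; for the zero code this is 0. *)
definition free_distance :: "nat \<Rightarrow> 'a::field poly vec set \<Rightarrow> nat" where
  "free_distance n C = Inf (weight ` (C - {0\<^sub>v n}))"

(* C is an (n, k, \<gamma>; \<mu>, d) convolutional code; q is the cardinality of the field 'a. *)
definition convolutional_code ::
    "nat \<Rightarrow> nat \<Rightarrow> nat \<Rightarrow> nat \<Rightarrow> nat \<Rightarrow> 'a::{field, finite} poly vec set \<Rightarrow> bool" where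
  "convolutional_code n k \<gamma> \<mu> d C \<longleftrightarrow>
     (\<exists>G \<in> carrier_mat k n.
        reduced_basic_generator_matrix n C G \<and>
        overall_constraint_length G = \<gamma> \<and>
        memory G = \<mu>) \<and>
     free_distance n C = d"

end

theory Submission
  imports
    Defs
    "HOL-Algebra.Algebraic_Closure_Type"
    "HOL-Number_Theory.Residues"
    "Jordan_Normal_Form.Determinant"
begin

text \<open>
  Let \<open>x\<close> range over the \<open>n = q\<^sup>2 - 1\<close> nonzero elements of the field with \<open>q\<^sup>2\<close> elements, and let \<open>M\<close> be the
  square matrix over \<open>F\<^sub>q\<close> whose rows are \<open>F\<^sub>q\<close>-coordinates of the rows \<open>(x\<^sup>i)\<^sub>x\<close>, \<open>i < n\<close>, of the Fourier
  matrix; the exponents \<open>i\<close> and \<open>q i mod n\<close> are conjugate and share two rows. By the BCH argument a nonzero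
  vector killed by the rows of a conjugation-closed set containing \<open>\<delta>\<close> consecutive exponents has weight
  greater than \<open>\<delta>\<close>; in particular \<open>M\<close> is invertible, with dual basis \<open>w\<^sub>i\<close>, the columns of the inverse.

  Choose disjoint conjugation-closed sets \<open>I \<supseteq> {0..q + 1}\<close> of size \<open>2 q\<close> and \<open>J \<supseteq> {q + 2..2 q - 1}\<close> of size
  \<open>2 q - 4\<close>. The generator matrix has one row \<open>w\<^sub>j\<close> for every \<open>j \<notin> I\<close>, to which \<open>D w\<^sub>i\<close> is added for \<open>j \<in> J\<close>,
  with distinct \<open>i = i(j) \<in> I\<close>. The rows of \<open>M\<close> outside \<open>I\<close> form a constant right inverse. In a nonzero
  codeword, the lowest coefficient vector is killed by the rows in \<open>I\<close> and the highest one by the rows in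
  \<open>J\<close>, so the weight is at least \<open>(q + 3) + (q - 1)\<close> if they differ and at least \<open>2 q + 1\<close> if they coincide.

  The matrix is reduced because the code contains only \<open>q\<^bsup>k - (2 q - 4)\<^esup>\<close> constant codewords, so that at most
  \<open>k - (2 q - 4)\<close> rows of any basic generator matrix have degree zero.
\<close>

unbundle no Formal_Power_Series.fps_syntax

section \<open>Parity checks from the field with \<open>q\<^sup>2\<close> elements\<close>

text \<open>If the support had at most \<open>\<delta>\<close> points, a polynomial \<open>p\<close>
  of degree below \<open>\<delta>\<close> could vanish at the locators of all of them but one,
  \<open>x0\<close>. Combining the syndromes with the coefficients of \<open>p\<close> isolates the
  single nonzero term at \<open>x0\<close>.\<close>

lemma bch_bound:
  fixes c a :: "'i \<Rightarrow> 'b::field"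
  assumes "finite J" "inj_on a J" "\<And>x. x \<in> J \<Longrightarrow> a x \<noteq> 0"
    and syndromes: "\<And>i. i \<in> {l..<l + \<delta>} \<Longrightarrow> (\<Sum>x\<in>J. c x * a x ^ i) = 0"
    and "\<exists>x\<in>J. c x \<noteq> 0"
  shows "\<delta> < card {x \<in> J. c x \<noteq> 0}"
proof (rule ccontr)
  define S where "S = {x \<in> J. c x \<noteq> 0}"
  assume "\<not> \<delta> < card {x \<in> J. c x \<noteq> 0}"
  hence le: "card S \<le> \<delta>" by (simp add: S_def)
  have fS: "finite S" "S \<subseteq> J" using assms(1) by (auto simp: S_def)
  obtain x0 where x0: "x0 \<in> S" using assms(5) by (auto simp: S_def)
  define p where "p = (\<Prod>y\<in>S - {x0}. [:- a y, 1:])"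
  have "Polynomial.degree p = card (S - {x0})"
    unfolding p_def by (subst degree_prod_eq_sum_degree) auto
  with x0 fS le have deg: "Polynomial.degree p < \<delta>"
    by (metis card_Diff1_less le_antisym less_le_trans nless_le)
  have "(\<Sum>x\<in>J. c x * a x ^ l * poly p (a x)) =
      (\<Sum>x\<in>J. \<Sum>j\<le>Polynomial.degree p. Polynomial.coeff p j * (c x * a x ^ (l + j)))"
    by (simp add: poly_altdef sum_distrib_left power_add mult_ac)
  also have "\<dots> = (\<Sum>j\<le>Polynomial.degree p. Polynomial.coeff p j * (\<Sum>x\<in>J. c x * a x ^ (l + j)))"
    by (subst sum.swap) (simp add: sum_distrib_left)
  also have "\<dots> = 0"
    using deg by (intro sum.neutral) (auto intro!: syndromes)
  finally have "(\<Sum>x\<in>J. c x * a x ^ l * poly p (a x)) = 0" .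
  moreover have "(\<Sum>x\<in>J. c x * a x ^ l * poly p (a x)) = c x0 * a x0 ^ l * poly p (a x0)"
  proof -
    have "c x * a x ^ l * poly p (a x) = 0" if "x \<in> J - {x0}" for x
      using that fS by (auto simp: S_def p_def poly_prod)
    thus ?thesis
      using x0 fS assms(1) sum.remove[of J x0 "\<lambda>x. c x * a x ^ l * poly p (a x)"]
      by (simp add: sum.neutral subset_iff del: mult_eq_0_iff)
  qed
  moreover have "poly p (a x0) \<noteq> 0"
    using fS x0 assms(2) by (auto simp: p_def poly_prod dest: inj_onD)
  ultimately show False
    using x0 fS assms(3) by (auto simp: S_def)
qed

section \<open>Roots of unity and Frobenius in the algebraic closure\<close>

lemma poly_pderiv_double_root:
  "poly (pderiv ([:-x, 1:] * ([:-x, 1:] * p))) x = (0 :: 'b::idom)"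
  by (simp add: pderiv_mult del: mult_pCons_left)

text \<open>A double root of \<open>x ^ n - 1\<close> would be a root of the derivative
  \<open>n * x ^ (n - 1)\<close>, hence 0, which is no root of unity.\<close>

lemma card_roots_of_unity_alg_closed:
  assumes "of_nat n \<noteq> (0 :: 'b::alg_closed_field)"
  shows "card {x::'b. x ^ n = 1} = n"
proof -
  have n: "n > 0" using assms by (cases n) auto
  define p :: "'b poly" where "p = Polynomial.monom 1 n + [:-1:]"
  have deg: "Polynomial.degree p = n"
    unfolding p_def using n by (subst degree_add_eq_left) (auto simp: Polynomial.degree_monom_eq)
  with n have p0: "p \<noteq> 0" by auto
  obtain A where A: "size A = n" "p = Polynomial.smult (Polynomial.lead_coeff p) (\<Prod>x\<in>#A. [:-x, 1:])"
    using alg_closed_imp_factorization[OF p0] deg by auto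
  have root: "poly p x = 0 \<longleftrightarrow> x ^ n = 1" for x
    by (simp add: p_def poly_monom)
  have "poly p x = 0 \<longleftrightarrow> x \<in># A" for x
    using p0 by (subst A(2)) (auto simp: poly_prod_mset prod_mset_zero_iff)
  hence set: "{x. x ^ n = 1} = set_mset A" using root by auto
  have "count A x = 1" if x: "x \<in># A" for x
  proof (rule ccontr)
    assume "count A x \<noteq> 1"
    with x have "x \<in># A - {#x#}"
      by (simp add: in_diff_count Suc_lessI)
    then obtain B where "A = add_mset x (add_mset x B)"
      using x by (metis insert_DiffM)
    hence "p = [:-x, 1:] * ([:-x, 1:] * Polynomial.smult (Polynomial.lead_coeff p) (\<Prod>y\<in>#B. [:-y, 1:]))"
      using A(2) by simp
    hence "poly (pderiv p) x = 0"
      by (metis poly_pderiv_double_root)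
    hence "of_nat n * x ^ (n - 1) = 0"
      by (simp add: p_def pderiv_add pderiv_monom poly_monom)
    hence "x = 0" using assms by simp
    moreover have "x ^ n = 1" using x set by auto
    ultimately show False using n by (simp add: power_0_left)
  qed
  hence "size A = card (set_mset A)" by (simp add: size_multiset_overloaded_eq)
  with A(1) set show ?thesis by simp
qed

lemma finite_field_power_card:
  fixes x :: "'a::{field, finite}"
  shows "x ^ CARD('a) = x"
proof (cases "x = 0")
  case False
  let ?U = "UNIV - {0 :: 'a}"
  have "x ^ card ?U * \<Prod>?U = (\<Prod>y\<in>?U. x * y)"
    by (simp add: prod.distrib)
  also have "\<dots> = \<Prod>?U"
    by (rule prod.reindex_bij_witness[of _ "\<lambda>y. y / x" "\<lambda>y. x * y"]) (use False in auto)
  finally have "x ^ card ?U = 1" by simp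
  moreover have "CARD('a) = Suc (card ?U)"
    by (simp add: card_Suc_Diff1)
  ultimately show ?thesis by (simp only: power_Suc mult_1_right)
qed (simp add: zero_power)

text \<open>The image of the field supplies \<open>CARD('a)\<close> roots of
  \<open>y ^ CARD('a) - y\<close>, which is all that the degree allows. Frobenius-fixed values can
  thus be pulled back to \<open>'a\<close>.\<close>

lemma range_to_ac:
  "range (to_ac :: 'a::{field, finite} \<Rightarrow> _) = {y. y ^ CARD('a) = y}"
proof (rule card_subset_eq)
  let ?p = "Polynomial.monom 1 CARD('a) + [:0, -1:] :: 'a alg_closure poly"
  have q: "CARD('a) > 1"
    using card_mono[of "UNIV :: 'a set" "{0, 1}"] by simp
  have "Polynomial.degree ?p = CARD('a)"
    using q by (subst degree_add_eq_left) (auto simp: Polynomial.degree_monom_eq)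
  moreover from this q have p0: "?p \<noteq> 0" by auto
  moreover have eq: "{y. poly ?p y = 0} = {y. y ^ CARD('a) = y}"
    by (auto simp: poly_monom)
  ultimately have le: "card {y :: 'a alg_closure. y ^ CARD('a) = y} \<le> CARD('a)"
    using card_poly_roots_bound[OF p0] by simp
  show fin: "finite {y :: 'a alg_closure. y ^ CARD('a) = y}"
    using poly_roots_finite[OF p0] eq by simp
  show sub: "range to_ac \<subseteq> {y :: 'a alg_closure. y ^ CARD('a) = y}"
    by (auto simp flip: to_ac_power simp: finite_field_power_card)
  have "card (range (to_ac :: 'a \<Rightarrow> _)) = CARD('a)"
    by (simp add: card_image inj_to_ac)
  with le card_mono[OF fin sub]
  show "card (range (to_ac :: 'a \<Rightarrow> _)) = card {y :: 'a alg_closure. y ^ CARD('a) = y}"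
    by simp
qed

lemma card_eq_CHAR_power:
  assumes "primepow CARD('a::{field, finite})"
  obtains e where "CARD('a) = CHAR('a) ^ e" "Factorial_Ring.prime CHAR('a)"
proof -
  obtain p e where pe: "Factorial_Ring.prime p" "e > 0" "CARD('a) = p ^ e"
    using assms by (auto simp: primepow_def)
  have "CHAR('a) > 0"
    by (rule finite_imp_CHAR_pos) simp
  hence "Factorial_Ring.prime CHAR('a)" by (rule prime_CHAR_semidom)
  moreover from this have "CHAR('a) = p"
    using CHAR_dvd_CARD[where 'a = 'a] pe by (metis prime_dvd_power primes_dvd_imp_eq)
  ultimately show ?thesis using that pe by auto
qed

lemma sum_power_card_alg_closure:
  fixes f :: "'i \<Rightarrow> 'a::{field, finite} alg_closure"
  assumes "primepow CARD('a)"
  shows "(\<Sum>i\<in>A. f i) ^ CARD('a) = (\<Sum>i\<in>A. f i ^ CARD('a))"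
proof -
  obtain e where e: "CARD('a) = CHAR('a) ^ e" "Factorial_Ring.prime CHAR('a)"
    by (rule card_eq_CHAR_power[OF assms])
  show ?thesis
    by (rule freshmans_dream_sum'[where n = e]) (simp_all only: CHAR_alg_closure e)
qed

text \<open>The locators are the \<open>n\<close>-th roots of unity in the algebraic closure, while
  the matrix has entries in \<open>'a\<close>. Closure of \<open>I\<close> under conjugation makes
  both rows of each conjugate pair available, so all power sums with exponents in \<open>I\<close>
  vanish and \<open>bch_bound\<close> applies.\<close>

lemma exists_bch_parity_check_matrix:
  assumes pp: "primepow CARD('a::{field, finite})" and n: "n = CARD('a)\<^sup>2 - 1"
  obtains M :: "'a::{field, finite} mat" where "M \<in> carrier_mat n n"
    and "\<And>z I l \<delta>. \<lbrakk>z \<in> carrier_vec n; z \<noteq> 0\<^sub>v n; I \<subseteq> {..<n}; {l..<l + \<delta>} \<subseteq> I;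
           \<And>i. i \<in> I \<Longrightarrow> i * CARD('a) mod n \<in> I; \<And>i. i \<in> I \<Longrightarrow> (M *\<^sub>v z) $ i = 0\<rbrakk>
         \<Longrightarrow> \<delta> < card {x. x < n \<and> z $ x \<noteq> 0}"
proof -
  define q where "q = CARD('a)"
  have q1: "q > 1"
    using card_mono[of "UNIV :: 'a set" "{0, 1}"] by (simp add: q_def)
  have n': "q\<^sup>2 = Suc n" using n q1 by (simp add: q_def)
  have "q * 1 < q * q" using q1 by (intro mult_strict_left_mono) auto
  hence qn: "q < Suc n" by (simp flip: n' add: power2_eq_square)
  have n0: "n > 0" using qn q1 by simp
  \<comment> \<open>The characteristic divides \<open>q\<close>, hence also
    \<open>q\<^sup>2 = Suc n\<close>; so \<open>n\<close> is -1 in the closure and in particular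
    nonzero.\<close>
  have "of_nat (Suc n) = (0 :: 'a alg_closure)"
  proof -
    have "CHAR('a alg_closure) dvd q"
      using CHAR_dvd_CARD[where 'a = 'a] by (simp add: q_def)
    hence "CHAR('a alg_closure) dvd Suc n"
      unfolding n'[symmetric] by (simp add: power2_eq_square)
    thus ?thesis by (simp only: of_nat_eq_0_iff_char_dvd)
  qed
  hence "of_nat n \<noteq> (0 :: 'a alg_closure)" by auto
  hence card_roots: "card {x :: 'a alg_closure. x ^ n = 1} = n"
    by (rule card_roots_of_unity_alg_closed)
  hence "finite {x :: 'a alg_closure. x ^ n = 1}" using n0 card_ge_0_finite by force
  with card_roots obtain a :: "nat \<Rightarrow> 'a alg_closure"
    where a: "bij_betw a {..<n} {x. x ^ n = 1}"
    by (metis bij_betw_iff_card card_lessThan finite_lessThan)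
  have an: "a x ^ n = 1" if "x < n" for x
    using a that by (auto simp: bij_betw_def)
  hence a0: "a x \<noteq> 0" if "x < n" for x
    using that n0 by (metis power_0_left not_gr_zero zero_neq_one less_nat_zero_code)
  have inj: "inj_on a {..<n}" using a by (auto simp: bij_betw_def)
  have amod: "a x ^ (i mod n) = a x ^ i" if "x < n" for x i
  proof -
    have "a x ^ i = a x ^ (n * (i div n) + i mod n)" by simp
    also have "\<dots> = a x ^ (i mod n)"
      unfolding power_add power_mult by (simp add: an that)
    finally show ?thesis ..
  qed
  have aq2: "(a x ^ i) ^ q ^ 2 = a x ^ i" if "x < n" for x i
  proof -
    have "(a x ^ i) ^ q ^ 2 = (a x ^ n) ^ i * a x ^ i"
      by (simp only: n' flip: power_mult power_add) (simp add: algebra_simps)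
    thus ?thesis by (simp add: an that)
  qed
  \<comment> \<open>\<open>\<sigma>\<close> is the action of Frobenius on exponents. It is an
    involution below \<open>n\<close> because \<open>q\<^sup>2\<close> is 1 modulo
    \<open>n\<close>.\<close>
  define \<sigma> where "\<sigma> i = i * q mod n" for i
  have \<sigma>\<sigma>: "\<sigma> (\<sigma> i) = i" if "i < n" for i
  proof -
    have "\<sigma> (\<sigma> i) = i * q\<^sup>2 mod n"
      by (simp add: \<sigma>_def power2_eq_square mod_mult_left_eq mult.assoc)
    also have "\<dots> = i" using that by (simp add: n')
    finally show ?thesis .
  qed
  have frob: "(u + v) ^ q = u ^ q + v ^ q" for u v :: "'a alg_closure"
    using sum_power_card_alg_closure[OF pp, of "\<lambda>b. if b then u else v" UNIV]
    by (simp add: UNIV_bool q_def add.commute)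
  \<comment> \<open>Otherwise \<open>q\<^sup>2\<close> elements would be fixed by Frobenius and lie
    in the image of \<open>'a\<close>, which has only \<open>q\<close> elements.\<close>
  have "\<exists>x<n. a x ^ q \<noteq> a x"
  proof (rule ccontr)
    assume "\<not> ?thesis"
    hence "insert 0 (a ` {..<n}) \<subseteq> range to_ac"
      using q1 by (auto simp: range_to_ac q_def zero_power)
    hence "card (insert 0 (a ` {..<n})) \<le> card (range (to_ac :: 'a \<Rightarrow> _))"
      by (intro card_mono) auto
    moreover have "card (insert 0 (a ` {..<n})) = Suc n"
      using a0 inj by (subst card_insert_disjoint) (auto simp: card_image)
    moreover have "card (range (to_ac :: 'a \<Rightarrow> _)) = q"
      by (simp add: card_image inj_to_ac q_def)
    ultimately show False using qn by simp
  qed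
  then obtain x\<theta> where x\<theta>: "x\<theta> < n" "a x\<theta> ^ q \<noteq> a x\<theta>" by blast
  define \<theta> where "\<theta> = a x\<theta>"
  have \<theta>: "\<theta> ^ q \<noteq> \<theta>" "\<theta> ^ q\<^sup>2 = \<theta>"
    using x\<theta> aq2[of x\<theta> 1] by (simp_all add: \<theta>_def)
  \<comment> \<open>One \<open>F\<^sub>q\<close>-valued row per exponent. The two rows of an orbit \<open>{i, \<sigma> i}\<close> are the traces of \<open>a\<^sup>i\<close> and of
    \<open>\<theta> (a\<^sup>i)\<^sup>q\<close>; since \<open>\<theta>\<^sup>q \<noteq> \<theta>\<close>, together they vanish on a vector iff its power sum of exponent \<open>i\<close> does.\<close>
  define \<rho> where "\<rho> i x = (if \<sigma> i = i then a x ^ i else if i < \<sigma> i then a x ^ i + (a x ^ i) ^ q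
     else \<theta> * a x ^ i + (\<theta> * a x ^ i) ^ q)" for i x
  have tr: "(u + u ^ q) ^ q = u + u ^ q" if "u ^ q\<^sup>2 = u" for u :: "'a alg_closure"
    using that by (simp add: frob power2_eq_square add.commute flip: power_mult)
  have \<rho>_q: "\<rho> i x ^ q = \<rho> i x" if "i < n" "x < n" for i x
  proof (cases "\<sigma> i = i")
    case True
    have "(a x ^ i) ^ q = a x ^ \<sigma> i" using that by (simp add: \<sigma>_def amod power_mult)
    with True show ?thesis by (simp add: \<rho>_def)
  next
    case False
    have "(\<theta> * a x ^ i) ^ q\<^sup>2 = \<theta> * a x ^ i"
      using that \<theta> by (simp only: power_mult_distrib aq2)
    with False tr tr[OF aq2] that show ?thesis by (simp add: \<rho>_def)
  qed
  define M :: "'a mat" where "M = mat n n (\<lambda>(i, x). of_ac (\<rho> i x))"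
  have M: "M \<in> carrier_mat n n" by (simp add: M_def)
  have to_ac_M: "to_ac (M $$ (i, x)) = \<rho> i x" if "i < n" "x < n" for i x
    using that \<rho>_q[OF that] range_to_ac[where 'a = 'a]
    by (simp add: M_def to_ac_of_ac q_def)
  have "\<delta> < card {x. x < n \<and> z $ x \<noteq> 0}"
    if z: "z \<in> carrier_vec n" "z \<noteq> 0\<^sub>v n" and I: "I \<subseteq> {..<n}" "{l..<l + \<delta>} \<subseteq> I"
      and I\<sigma>: "\<And>i. i \<in> I \<Longrightarrow> i * CARD('a) mod n \<in> I"
      and Mz: "\<And>i. i \<in> I \<Longrightarrow> (M *\<^sub>v z) $ i = 0" for z :: "'a vec" and I l \<delta>
  proof -
    define s where "s i = (\<Sum>x<n. to_ac (z $ x) * a x ^ i)" for i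
    have s_q: "s i ^ q = s (\<sigma> i)" for i
    proof -
      have "s i ^ q = (\<Sum>x<n. to_ac (z $ x) ^ q * a x ^ (i * q))"
        unfolding s_def q_def
        by (subst sum_power_card_alg_closure[OF pp]) (simp add: power_mult power_mult_distrib)
      also have "\<dots> = s (\<sigma> i)"
        unfolding s_def \<sigma>_def
        by (intro sum.cong) (auto simp: amod q_def finite_field_power_card simp flip: to_ac_power)
      finally show ?thesis .
    qed
    have syn: "(\<Sum>x<n. to_ac (z $ x) * \<rho> i x) = 0" if "i \<in> I" for i
    proof -
      have "i < n" using that I by auto
      hence "(M *\<^sub>v z) $ i = (\<Sum>x<n. M $$ (i, x) * z $ x)"
        using M z by (simp add: scalar_prod_def atLeast0LessThan row_def)
      hence "0 = to_ac (\<Sum>x<n. M $$ (i, x) * z $ x)" using Mz[OF that] by simp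
      also have "\<dots> = (\<Sum>x<n. to_ac (z $ x) * \<rho> i x)"
        using \<open>i < n\<close> by (simp add: to_ac_sum to_ac_M mult.commute)
      finally show ?thesis by simp
    qed
    have pair: "s i = 0 \<and> s (\<sigma> i) = 0" if i: "i \<in> I" "i < \<sigma> i" for i
    proof -
      have "i < n" using i I by auto
      have 1: "s i + s (\<sigma> i) = 0"
      proof -
        have "(\<Sum>x<n. to_ac (z $ x) * \<rho> i x) = s i + s (\<sigma> i)"
          unfolding s_def sum.distrib[symmetric]
          using i(2) by (intro sum.cong) (auto simp: \<rho>_def \<sigma>_def amod power_mult ring_distribs)
        with syn[OF i(1)] show ?thesis by simp
      qed
      have 2: "\<theta> * s (\<sigma> i) + \<theta> ^ q * s i = 0"
      proof -
        have "(\<Sum>x<n. to_ac (z $ x) * \<rho> (\<sigma> i) x) = \<theta> * s (\<sigma> i) + \<theta> ^ q * s i"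
          unfolding s_def sum_distrib_left sum.distrib[symmetric]
        proof (intro sum.cong refl)
          fix x assume "x \<in> {..<n}"
          hence "(a x ^ \<sigma> i) ^ q = a x ^ (\<sigma> (\<sigma> i))"
            by (simp add: \<sigma>_def[of "\<sigma> i"] amod power_mult)
          thus "to_ac (z $ x) * \<rho> (\<sigma> i) x =
              \<theta> * (to_ac (z $ x) * a x ^ \<sigma> i) + \<theta> ^ q * (to_ac (z $ x) * a x ^ i)"
            using i(2) \<open>i < n\<close> by (simp add: \<rho>_def \<sigma>\<sigma> power_mult_distrib algebra_simps)
        qed
        moreover have "\<sigma> i \<in> I" using I\<sigma>[OF i(1)] by (simp add: \<sigma>_def q_def)
        ultimately show ?thesis using syn by simp
      qed
      have "s (\<sigma> i) = - s i" using 1 by (simp add: add_eq_0_iff add.commute)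
      with 2 have "(\<theta> ^ q - \<theta>) * s i = 0" by (simp add: algebra_simps)
      with \<theta>(1) 1 show ?thesis by simp
    qed
    have "s i = 0" if "i \<in> I" for i
    proof (cases i "\<sigma> i" rule: linorder_cases)
      case equal
      from syn[OF that] equal[symmetric] show ?thesis unfolding \<rho>_def s_def by simp
    next
      \<comment> \<open>The pair is entered through its smaller member \<open>\<sigma> i\<close>,
        whose conjugate is \<open>i\<close>.\<close>
      case greater
      have "i < n" "\<sigma> i \<in> I" using that I I\<sigma> by (auto simp: \<sigma>_def q_def)
      with pair[of "\<sigma> i"] greater show ?thesis by (simp add: \<sigma>\<sigma>)
    qed (use pair that in blast)
    moreover have "\<exists>x\<in>{..<n}. to_ac (z $ x) \<noteq> 0"
      using z by (auto simp: vec_eq_iff)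
    ultimately have "\<delta> < card {x \<in> {..<n}. to_ac (z $ x) \<noteq> 0}"
      using I(2) inj a0 by (intro bch_bound[of "{..<n}" a l]) (auto simp: s_def)
    thus ?thesis by simp
  qed
  with M show ?thesis using that by blast
qed

section \<open>Encoding with basic matrices\<close>

text \<open>Messages are functions, so that no dimension has to be tracked for them; only the values
  below \<open>dim_row G\<close> matter.\<close>

definition encode :: "'a::field poly mat \<Rightarrow> (nat \<Rightarrow> 'a poly) \<Rightarrow> 'a poly vec" where
  "encode G u = vec (dim_col G) (\<lambda>x. \<Sum>r<dim_row G. u r * G $$ (r, x))"

lemma code_of_eq_range_encode: "code_of G = range (encode G)"
proof -
  have eq: "transpose_mat G *\<^sub>v u = encode G (\<lambda>r. u $ r)" if "u \<in> carrier_vec (dim_row G)" for u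
    using that by (intro eq_vecI)
      (auto simp: encode_def scalar_prod_def atLeast0LessThan mult.commute intro!: sum.cong)
  have "encode G u = transpose_mat G *\<^sub>v vec (dim_row G) u" for u
    by (subst eq) (auto simp: encode_def)
  hence "encode G u \<in> code_of G" for u
    unfolding code_of_def by (intro CollectI exI[of _ "vec (dim_row G) u"]) simp
  moreover have "code_of G \<subseteq> range (encode G)"
    using eq by (auto simp: code_of_def)
  ultimately show ?thesis by blast
qed

text \<open>\<open>h\<close> consists of the entries of a polynomial right inverse, so a message is
  recovered linearly from its codeword.\<close>

lemma basic_matrix_decode:
  assumes "basic_matrix G"
  obtains h where "\<And>u r. r < dim_row G \<Longrightarrow> (\<Sum>x<dim_col G. encode G u $ x * h x r) = u r"
proof -
  obtain H where H: "H \<in> carrier_mat (dim_col G) (dim_row G)" "G * H = 1\<^sub>m (dim_row G)"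
    using assms by (auto simp: basic_matrix_def)
  have GH: "(\<Sum>x<dim_col G. G $$ (s, x) * H $$ (x, r)) = (if s = r then 1 else 0)"
    if "s < dim_row G" "r < dim_row G" for s r
  proof -
    have "(G * H) $$ (s, r) = (\<Sum>x<dim_col G. G $$ (s, x) * H $$ (x, r))"
      using that H(1) by (simp add: scalar_prod_def atLeast0LessThan)
    with that H(2) show ?thesis by simp
  qed
  have "(\<Sum>x<dim_col G. encode G u $ x * H $$ (x, r)) = u r" if "r < dim_row G" for u r
  proof -
    have "(\<Sum>x<dim_col G. encode G u $ x * H $$ (x, r)) =
        (\<Sum>x<dim_col G. \<Sum>s<dim_row G. u s * (G $$ (s, x) * H $$ (x, r)))"
      by (simp add: encode_def sum_distrib_right mult.assoc)
    also have "\<dots> = (\<Sum>s<dim_row G. u s * (\<Sum>x<dim_col G. G $$ (s, x) * H $$ (x, r)))"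
      by (subst sum.swap) (simp add: sum_distrib_left)
    also have "\<dots> = (\<Sum>s<dim_row G. if s = r then u s else 0)"
      using that by (intro sum.cong) (auto simp: GH)
    finally show ?thesis using that by simp
  qed
  with that[of "\<lambda>x r. H $$ (x, r)"] show ?thesis by blast
qed

text \<open>The constant terms of the codewords form a vector space of dimension \<^term>\<open>dim_row G\<close> when
  \<^term>\<open>G\<close> is basic.\<close>

lemma dim_row_le_of_code_subset:
  fixes G G' :: "'a::{field, finite} poly mat"
  assumes "basic_matrix G" "dim_col G = dim_col G'" "code_of G \<subseteq> code_of G'"
  shows "dim_row G \<le> dim_row G'"
proof -
  let ?U = "\<lambda>k. {..<k::nat} \<rightarrow>\<^sub>E (UNIV :: 'a set)"
  let ?c = "\<lambda>v. \<lambda>x\<in>{..<dim_col G}. Polynomial.coeff (v $ x :: 'a poly) 0"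
  let ?e = "\<lambda>u. ?c (encode G (\<lambda>r. [:u r:]))"
  define e' where "e' = (\<lambda>u. \<lambda>x\<in>{..<dim_col G}. \<Sum>r<dim_row G'. u r * Polynomial.coeff (G' $$ (r, x)) 0)"
  obtain h where h: "\<And>u r. r < dim_row G \<Longrightarrow> (\<Sum>x<dim_col G. encode G u $ x * h x r) = u r"
    using basic_matrix_decode[OF assms(1)] by blast
  have "inj_on ?e (?U (dim_row G))"
  proof (rule inj_onI)
    fix u w assume uw: "u \<in> ?U (dim_row G)" "w \<in> ?U (dim_row G)" and eq: "?e u = ?e w"
    \<comment> \<open>Taking constant terms is a ring homomorphism, so the constant terms of the
      codeword determine a constant message.\<close>
    have dec: "t r = (\<Sum>x<dim_col G. ?e t x * Polynomial.coeff (h x r) 0)" if "r < dim_row G" for t r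
    proof -
      have "t r = Polynomial.coeff (\<Sum>x<dim_col G. encode G (\<lambda>r. [:t r:]) $ x * h x r) 0"
        by (subst h[OF that]) simp
      thus ?thesis by (simp add: coeff_sum coeff_mult_0)
    qed
    show "u = w"
    proof (rule PiE_ext[OF uw])
      fix r assume "r \<in> {..<dim_row G}"
      thus "u r = w r" using dec[of r u] dec[of r w] by (simp only: eq lessThan_iff)
    qed
  qed
  moreover have "?e ` ?U (dim_row G) \<subseteq> e' ` ?U (dim_row G')"
  proof (rule image_subsetI)
    fix u
    obtain w where w: "encode G (\<lambda>r. [:u r:]) = encode G' w"
      using assms(3) by (auto simp: code_of_eq_range_encode)
    \<comment> \<open>The message \<open>w\<close> may have any degree, but only its constant terms
      reach the constant terms of the codeword.\<close>
    have "?e u = e' (\<lambda>r\<in>{..<dim_row G'}. Polynomial.coeff (w r) 0)"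
      unfolding w e'_def by (rule ext) (auto simp: encode_def assms(2) coeff_sum coeff_mult_0)
    also have "\<dots> \<in> e' ` ?U (dim_row G')" by (intro imageI PiE_I) simp_all
    finally show "?e u \<in> e' ` ?U (dim_row G')" .
  qed
  ultimately have "card (?U (dim_row G)) \<le> card (e' ` ?U (dim_row G'))"
    by (intro card_inj_on_le[of ?e]) (simp_all add: finite_PiE)
  also have "\<dots> \<le> card (?U (dim_row G'))"
    by (intro card_image_le) (simp add: finite_PiE)
  finally have "card (?U (dim_row G)) \<le> card (?U (dim_row G'))" .
  hence "CARD('a) ^ dim_row G \<le> CARD('a) ^ dim_row G'"
    by (simp add: card_PiE)
  moreover have "CARD('a) > 1"
    using card_mono[of "UNIV :: 'a set" "{0, 1}"] by simp
  ultimately show ?thesis by (rule power_le_imp_le_exp[rotated])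
qed

section \<open>Counting constant codewords, and slicing the weight by powers of
  \<open>D\<close>\<close>

definition constant_codewords :: "'a::field poly mat \<Rightarrow> 'a poly vec set" where
  "constant_codewords G = {v \<in> code_of G. \<forall>x<dim_col G. Polynomial.degree (v $ x) = 0}"

text \<open>Constant messages supported on the rows of degree zero have constant codewords, and
  decoding makes this encoding injective.\<close>

lemma card_constant_codewords_ge:
  fixes G :: "'a::{field, finite} poly mat"
  assumes "basic_matrix G" "finite (constant_codewords G)"
  shows "CARD('a) ^ card {r. r < dim_row G \<and> row_degree G r = 0} \<le> card (constant_codewords G)"
proof -
  let ?Z = "{r. r < dim_row G \<and> row_degree G r = 0}"
  let ?e = "\<lambda>u. encode G (\<lambda>r. if r \<in> ?Z then [:u r :: 'a:] else 0)"
  obtain h where h: "\<And>u r. r < dim_row G \<Longrightarrow> (\<Sum>x<dim_col G. encode G u $ x * h x r) = u r"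
    using basic_matrix_decode[OF assms(1)] by blast
  have "inj_on ?e (?Z \<rightarrow>\<^sub>E UNIV)"
  proof (rule inj_onI)
    fix u w assume uw: "u \<in> ?Z \<rightarrow>\<^sub>E UNIV" "w \<in> ?Z \<rightarrow>\<^sub>E UNIV" and eq: "?e u = ?e w"
    have "[:u r:] = [:w r:]" if "r \<in> ?Z" for r
      using that h[of r "\<lambda>r. if r \<in> ?Z then [:u r:] else 0"]
        h[of r "\<lambda>r. if r \<in> ?Z then [:w r:] else 0"]
      unfolding eq by simp
    thus "u = w" by (intro PiE_ext[OF uw]) simp
  qed
  moreover have "?e ` (?Z \<rightarrow>\<^sub>E UNIV) \<subseteq> constant_codewords G"
  proof (rule image_subsetI)
    fix u
    have "Polynomial.degree (?e u $ x) \<le> 0" if x: "x < dim_col G" for x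
    proof -
      have le: "Polynomial.degree (G $$ (r, x)) \<le> row_degree G r" for r
        unfolding row_degree_def using x by (intro Max_ge) auto
      have le0: "Polynomial.degree ((if r \<in> ?Z then [:u r:] else 0) * G $$ (r, x)) \<le> 0" for r
        using Polynomial.degree_mult_le[of "[:u r:]" "G $$ (r, x)"] le[of r] by auto
      show ?thesis
        using x unfolding encode_def by (simp only: index_vec) (rule degree_sum_le, simp, rule le0)
    qed
    thus "?e u \<in> constant_codewords G"
      by (auto simp: constant_codewords_def code_of_eq_range_encode)
  qed
  ultimately have "card (?Z \<rightarrow>\<^sub>E (UNIV :: 'a set)) \<le> card (constant_codewords G)"
    using assms(2) by (rule card_inj_on_le)
  thus ?thesis by (simp add: card_PiE)
qed

lemma sum_card_coeff_le_weight:
  fixes v :: "'a::field poly vec"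
  assumes "finite S"
  shows "(\<Sum>m\<in>S. card {x. x < dim_vec v \<and> Polynomial.coeff (v $ x) m \<noteq> 0}) \<le> weight v"
proof -
  have "(\<Sum>m\<in>S. card {x. x < dim_vec v \<and> Polynomial.coeff (v $ x) m \<noteq> 0}) =
      (\<Sum>x<dim_vec v. card {m \<in> S. Polynomial.coeff (v $ x) m \<noteq> 0})"
    using sum.swap_restrict[of S "{..<dim_vec v}" "\<lambda>_ _. 1::nat" "\<lambda>m x. Polynomial.coeff (v $ x) m \<noteq> 0"] assms
    by simp
  also have "\<dots> \<le> weight v"
    unfolding weight_def
  proof (intro sum_mono card_mono)
    show "finite {m. Polynomial.coeff (v $ x) m \<noteq> 0}" for x
      by (rule finite_subset[of _ "{..Polynomial.degree (v $ x)}"]) (auto simp: Polynomial.le_degree)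
  qed auto
  finally show ?thesis .
qed

section \<open>Unit memory codes from an invertible matrix\<close>

text \<open>The rows of \<open>M\<close> are parity checks and the columns of \<open>N\<close> their
  dual basis. In the application \<open>g\<close> enumerates the indices outside \<open>I\<close>,
  beginning with those of \<open>J\<close>, and \<open>f\<close> picks \<open>\<mu>\<close> distinct
  indices in \<open>I\<close>.\<close>

locale unit_memory_code =
  fixes n k \<mu> :: nat and M N :: "'a::{field, finite} mat" and f g :: "nat \<Rightarrow> nat"
  assumes M: "M \<in> carrier_mat n n" and N: "N \<in> carrier_mat n n" and MN: "M * N = 1\<^sub>m n"
    and inj_g: "inj_on g {..<k}" and g_lt: "\<And>r. r < k \<Longrightarrow> g r < n"
    and inj_f: "inj_on f {..<\<mu>}" and f_lt: "\<And>r. r < \<mu> \<Longrightarrow> f r < n"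
    and f_g: "\<And>r s. r < \<mu> \<Longrightarrow> s < k \<Longrightarrow> f r \<noteq> g s"
    and \<mu>_le: "\<mu> \<le> k" and \<mu>_pos: "0 < \<mu>"
begin

definition G :: "'a poly mat" where
  "G = mat k n (\<lambda>(r, x). [:N $$ (x, g r), if r < \<mu> then N $$ (x, f r) else 0:])"

text \<open>The coordinate of \<open>v\<close> along column \<open>i\<close> of \<open>N\<close>;
  its coefficient at \<open>D ^ m\<close> is check \<open>i\<close> applied to the coefficient
  vector of \<open>v\<close> at \<open>D ^ m\<close>.\<close>

definition syndrome :: "'a poly vec \<Rightarrow> nat \<Rightarrow> 'a poly" where
  "syndrome v i = (\<Sum>x<n. Polynomial.smult (M $$ (i, x)) (v $ x))"

lemma dim_G [simp]: "dim_row G = k" "dim_col G = n" and G_carrier: "G \<in> carrier_mat k n"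
  by (simp_all add: G_def)

lemma sum_MN: "i < n \<Longrightarrow> j < n \<Longrightarrow> (\<Sum>x<n. M $$ (i, x) * N $$ (x, j)) = (if i = j then 1 else 0)"
  using arg_cong[OF MN, of "\<lambda>A. A $$ (i, j)"] M N by (simp add: scalar_prod_def atLeast0LessThan)

lemma syndrome_row:
  assumes "r < k" "i < n"
  shows "(\<Sum>x<n. Polynomial.smult (M $$ (i, x)) (G $$ (r, x))) =
    [:if i = g r then 1 else 0, if r < \<mu> \<and> i = f r then 1 else 0:]"
proof -
  have "(\<Sum>x<n. Polynomial.smult (M $$ (i, x)) (G $$ (r, x))) =
      (\<Sum>x<n. [:M $$ (i, x) * N $$ (x, g r), M $$ (i, x) * (if r < \<mu> then N $$ (x, f r) else 0):])"
    using assms by (intro sum.cong) (auto simp: G_def)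
  also have "\<dots> = [:\<Sum>x<n. M $$ (i, x) * N $$ (x, g r),
      \<Sum>x<n. M $$ (i, x) * (if r < \<mu> then N $$ (x, f r) else 0):]"
    by (intro poly_eqI) (auto simp: coeff_sum coeff_pCons split: nat.splits)
  also have "\<dots> = [:if i = g r then 1 else 0, if r < \<mu> \<and> i = f r then 1 else 0:]"
    using assms g_lt f_lt by (cases "r < \<mu>") (simp_all add: sum_MN)
  finally show ?thesis .
qed

lemma syndrome_encode:
  assumes "i < n"
  shows "syndrome (encode G u) i =
    (\<Sum>r<k. u r * [:if i = g r then 1 else 0, if r < \<mu> \<and> i = f r then 1 else 0:])"
proof -
  have smult_sum: "Polynomial.smult c (\<Sum>r<k. p r) = (\<Sum>r<k. Polynomial.smult c (p r))" for c and p :: "nat \<Rightarrow> 'a poly"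
    by (intro poly_eqI) (simp add: coeff_sum sum_distrib_left)
  have "syndrome (encode G u) i =
      (\<Sum>x<n. \<Sum>r<k. u r * Polynomial.smult (M $$ (i, x)) (G $$ (r, x)))"
    by (simp add: syndrome_def encode_def smult_sum mult_smult_right)
  also have "\<dots> = (\<Sum>r<k. u r * (\<Sum>x<n. Polynomial.smult (M $$ (i, x)) (G $$ (r, x))))"
    by (subst sum.swap) (simp add: sum_distrib_left)
  finally show ?thesis using assms by (simp add: syndrome_row)
qed

lemma syndrome_g:
  assumes "s < k"
  shows "syndrome (encode G u) (g s) = u s"
proof -
  have "syndrome (encode G u) (g s) = (\<Sum>r<k. if r = s then u r else 0)"
    unfolding syndrome_encode[OF g_lt[OF assms]]
  proof (intro sum.cong refl)
    fix r assume "r \<in> {..<k}"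
    hence 1: "(g s = g r) = (r = s)" using inj_g assms by (auto simp: inj_on_def)
    have 2: "(r < \<mu> \<and> g s = f r) = False" using f_g[of r s] assms by auto
    show "u r * [:if g s = g r then 1 else 0, if r < \<mu> \<and> g s = f r then 1 else 0:] =
        (if r = s then u r else 0)" unfolding 1 2 by simp
  qed
  with assms show ?thesis by simp
qed

text \<open>Only row \<open>s\<close> involves column \<open>f s\<close> of \<open>N\<close>, and it
  does so with a factor \<open>D\<close>. This shift relative to \<open>syndrome_g\<close> links the
  checks on neighbouring coefficient vectors.\<close>

lemma syndrome_f:
  assumes "s < \<mu>"
  shows "syndrome (encode G u) (f s) = pCons 0 (u s)"
proof -
  have "syndrome (encode G u) (f s) = (\<Sum>r<k. if r = s then pCons 0 (u r) else 0)"
    unfolding syndrome_encode[OF f_lt[OF assms]]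
  proof (intro sum.cong refl)
    fix r assume "r \<in> {..<k}"
    hence 1: "(f s = g r) = False" using f_g assms by simp
    have 2: "(r < \<mu> \<and> f s = f r) = (r = s)" using inj_f assms by (auto simp: inj_on_def)
    show "u r * [:if f s = g r then 1 else 0, if r < \<mu> \<and> f s = f r then 1 else 0:] =
        (if r = s then pCons 0 (u r) else 0)" unfolding 1 2 by simp
  qed
  with assms \<mu>_le show ?thesis by simp
qed

lemma syndrome_other:
  "i < n \<Longrightarrow> i \<notin> g ` {..<k} \<Longrightarrow> i \<notin> f ` {..<\<mu>} \<Longrightarrow> syndrome (encode G u) i = 0"
  by (subst syndrome_encode) (auto intro!: sum.neutral)

lemma basic_G: "basic_matrix G"
proof -
  define H where "H = mat n k (\<lambda>(x, s). [:M $$ (g s, x):])"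
  have "(G * H) $$ (r, s) = 1\<^sub>m k $$ (r, s)" if "r < k" "s < k" for r s
  proof -
    have "(G * H) $$ (r, s) = (\<Sum>x<n. Polynomial.smult (M $$ (g s, x)) (G $$ (r, x)))"
      using that by (simp add: scalar_prod_def H_def atLeast0LessThan G_carrier)
    also have "\<dots> = [:if g s = g r then 1 else 0, if r < \<mu> \<and> g s = f r then 1 else 0:]"
      by (rule syndrome_row[OF that(1) g_lt[OF that(2)]])
    also have "(g s = g r) = (r = s)" using inj_g that by (auto simp: inj_on_def)
    also have "(r < \<mu> \<and> g s = f r) = False" using f_g[of r s] that by auto
    finally show ?thesis using that by (simp add: one_pCons)
  qed
  hence "G * H = 1\<^sub>m k" by (intro eq_matI) (auto simp: H_def)
  thus ?thesis unfolding basic_matrix_def by (intro bexI[of _ H]) (simp_all add: H_def)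
qed

section \<open>Row degrees and minimality of the overall constraint length\<close>

lemma row_degree_G:
  assumes "r < k"
  shows "row_degree G r = (if r < \<mu> then 1 else 0)"
proof -
  have n: "0 < n" using g_lt[OF assms] by simp
  have ge: "Polynomial.degree (G $$ (r, x)) \<le> row_degree G r" if "x < n" for x
    unfolding row_degree_def using that by (intro Max_ge) auto
  have le: "row_degree G r \<le> d" if "\<And>x. x < n \<Longrightarrow> Polynomial.degree (G $$ (r, x)) \<le> d" for d
    unfolding row_degree_def using that n by (subst Max_le_iff) auto
  show ?thesis
  proof (cases "r < \<mu>")
    case True
    have "\<exists>x<n. N $$ (x, f r) \<noteq> 0"
      using sum_MN[OF f_lt f_lt, OF True True] by (auto intro: ccontr)
    then obtain x where "x < n" "N $$ (x, f r) \<noteq> 0" by blast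
    hence "1 \<le> row_degree G r" using ge[of x] assms True by (simp add: G_def)
    moreover have "row_degree G r \<le> 1" using assms by (intro le) (auto simp: G_def)
    ultimately show ?thesis using True by simp
  next
    case False
    with assms have "row_degree G r \<le> 0" by (intro le) (auto simp: G_def)
    with False show ?thesis by simp
  qed
qed

lemma overall_constraint_length_G: "overall_constraint_length G = \<mu>"
proof -
  have "overall_constraint_length G = (\<Sum>r<k. if r < \<mu> then 1 else 0)"
    unfolding overall_constraint_length_def by (intro sum.cong) (auto simp: row_degree_G)
  also have "\<dots> = card ({..<k} \<inter> {r. r < \<mu>})" by (simp add: sum.If_cases)
  also have "{..<k} \<inter> {r. r < \<mu>} = {..<\<mu>}" using \<mu>_le by auto
  finally show ?thesis by simp
qed

lemma memory_G: "memory G = 1"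
proof -
  have "row_degree G ` {..<k} = (\<lambda>r. if r < \<mu> then 1 else 0) ` {..<k}"
    by (intro image_cong) (auto simp: row_degree_G)
  moreover have "0 < k" using \<mu>_pos \<mu>_le by simp
  moreover have "1 \<in> (\<lambda>r. if r < \<mu> then 1 else 0 :: nat) ` {..<k}"
    using \<mu>_pos \<open>0 < k\<close> by (intro image_eqI[of _ _ 0]) auto
  ultimately show ?thesis unfolding memory_def by (auto intro!: Max_eqI)
qed

text \<open>A constant codeword has constant syndromes. At \<open>g r\<close> this makes
  \<open>u r\<close> constant; at \<open>f r\<close> the syndrome is \<open>D\<close> times
  \<open>u r\<close>, which forces \<open>u r = 0\<close> for \<open>r < \<mu>\<close>.\<close>

lemma constant_codewords_G:
  "constant_codewords G \<subseteq> (\<lambda>u. encode G (\<lambda>r. if r \<in> {\<mu>..<k} then [:u r:] else 0)) ` ({\<mu>..<k} \<rightarrow>\<^sub>E UNIV)"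
proof
  fix v assume v: "v \<in> constant_codewords G"
  then obtain u where u: "v = encode G u"
    by (auto simp: constant_codewords_def code_of_eq_range_encode)
  have "Polynomial.degree (syndrome v i) \<le> 0" for i
    unfolding syndrome_def using v
    by (intro degree_sum_le) (auto simp: constant_codewords_def intro: le_trans[OF degree_smult_le])
  hence deg: "Polynomial.degree (syndrome v i) = 0" for i by simp
  have u_const: "u r = [:Polynomial.coeff (u r) 0:]" if "r < k" for r
    using deg[of "g r"] syndrome_g[OF that, of u] by (auto simp: u elim!: degree_eq_zeroE)
  have u_0: "u r = 0" if "r < \<mu>" for r
    using deg[of "f r"] syndrome_f[OF that, of u] by (auto simp: u degree_pCons_eq_if split: if_splits)
  have "u r = (if r \<in> {\<mu>..<k} then [:(\<lambda>r\<in>{\<mu>..<k}. Polynomial.coeff (u r) 0) r:] else 0)" if "r < k" for r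
    using that u_const[of r] u_0[of r] by (cases "r < \<mu>") auto
  hence "v = encode G (\<lambda>r. if r \<in> {\<mu>..<k} then [:(\<lambda>r\<in>{\<mu>..<k}. Polynomial.coeff (u r) 0) r:] else 0)"
    unfolding u encode_def by (intro eq_vecI) (auto intro!: sum.cong)
  also have "\<dots> \<in> (\<lambda>u. encode G (\<lambda>r. if r \<in> {\<mu>..<k} then [:u r:] else 0)) ` ({\<mu>..<k} \<rightarrow>\<^sub>E UNIV)"
    by (intro imageI PiE_I) auto
  finally show "v \<in> (\<lambda>u. encode G (\<lambda>r. if r \<in> {\<mu>..<k} then [:u r:] else 0)) ` ({\<mu>..<k} \<rightarrow>\<^sub>E UNIV)" .
qed

text \<open>The constant codewords depend on the code alone, so \<open>G'\<close> has at most
  \<open>k - \<mu>\<close> rows of degree zero. It has at least \<open>k\<close> rows, and each of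
  the others contributes at least 1.\<close>

lemma overall_constraint_length_minimal:
  assumes "basic_generator_matrix n (code_of G) G'"
  shows "\<mu> \<le> overall_constraint_length G'"
proof -
  have G': "dim_col G' = n" "basic_matrix G'" "code_of G' = code_of G"
    using assms by (auto simp: basic_generator_matrix_def)
  define Z where "Z = {r. r < dim_row G' \<and> row_degree G' r = 0}"
  have k: "k \<le> dim_row G'"
    using dim_row_le_of_code_subset[OF basic_G, of G'] G' by simp
  have eq: "constant_codewords G' = constant_codewords G"
    using G' by (simp add: constant_codewords_def)
  have fin: "finite ({\<mu>..<k} \<rightarrow>\<^sub>E (UNIV :: 'a set))" by (simp add: finite_PiE)
  have finC: "finite (constant_codewords G)"
    using finite_subset[OF constant_codewords_G] fin by blast
  have "CARD('a) ^ card Z \<le> card (constant_codewords G)"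
    using card_constant_codewords_ge[OF G'(2)] finC by (simp add: eq Z_def)
  also have "\<dots> \<le> card ({\<mu>..<k} \<rightarrow>\<^sub>E (UNIV :: 'a set))"
    using constant_codewords_G fin by (rule surj_card_le[rotated])
  also have "\<dots> = CARD('a) ^ (k - \<mu>)" by (simp add: card_PiE)
  finally have "CARD('a) ^ card Z \<le> CARD('a) ^ (k - \<mu>)" .
  moreover have "CARD('a) > 1"
    using card_mono[of "UNIV :: 'a set" "{0, 1}"] by simp
  ultimately have "card Z \<le> k - \<mu>" by (rule power_le_imp_le_exp[rotated])
  moreover have "dim_row G' = card Z + card ({..<dim_row G'} - Z)"
  proof -
    have "Z \<subseteq> {..<dim_row G'}" by (auto simp: Z_def)
    thus ?thesis using card_Diff_subset[of Z "{..<dim_row G'}"] card_mono[of "{..<dim_row G'}" Z]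
      by (simp add: finite_subset)
  qed
  moreover have "card ({..<dim_row G'} - Z) \<le> overall_constraint_length G'"
  proof -
    have "card ({..<dim_row G'} - Z) = (\<Sum>r\<in>{..<dim_row G'} - Z. 1)" by simp
    also have "\<dots> \<le> (\<Sum>r\<in>{..<dim_row G'} - Z. row_degree G' r)"
      by (intro sum_mono) (auto simp: Z_def)
    also have "\<dots> \<le> overall_constraint_length G'"
      unfolding overall_constraint_length_def by (intro sum_mono2) auto
    finally show ?thesis .
  qed
  ultimately show ?thesis using k \<mu>_le by linarith
qed

section \<open>Free distance\<close>

text \<open>\<open>A\<close> bounds the lowest nonzero coefficient vector, \<open>B\<close> the
  highest, and \<open>AB\<close> covers the case that they coincide.\<close>

lemma weight_code_ge:
  assumes v: "v \<in> code_of G" "v \<noteq> 0\<^sub>v n"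
    and A: "\<And>z. \<lbrakk>z \<in> carrier_vec n; z \<noteq> 0\<^sub>v n; \<And>i. i \<in> {..<n} - g ` {..<k} \<Longrightarrow> (M *\<^sub>v z) $ i = 0\<rbrakk>
        \<Longrightarrow> dA \<le> card {x. x < n \<and> z $ x \<noteq> 0}"
    and B: "\<And>z. \<lbrakk>z \<in> carrier_vec n; z \<noteq> 0\<^sub>v n; \<And>i. i \<in> g ` {..<\<mu>} \<Longrightarrow> (M *\<^sub>v z) $ i = 0\<rbrakk>
        \<Longrightarrow> dB \<le> card {x. x < n \<and> z $ x \<noteq> 0}"
    and AB: "\<And>z. \<lbrakk>z \<in> carrier_vec n; z \<noteq> 0\<^sub>v n;
          \<And>i. i \<in> ({..<n} - g ` {..<k}) \<union> g ` {..<\<mu>} \<Longrightarrow> (M *\<^sub>v z) $ i = 0\<rbrakk>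
        \<Longrightarrow> d \<le> card {x. x < n \<and> z $ x \<noteq> 0}"
    and d: "d \<le> dA + dB"
  shows "d \<le> weight v"
proof -
  obtain u where u: "v = encode G u" using v by (auto simp: code_of_eq_range_encode)
  have dim: "dim_vec v = n" by (simp add: u encode_def)
  define cv where "cv m = vec n (\<lambda>x. Polynomial.coeff (v $ x) m)" for m
  define wt where "wt m = card {x. x < n \<and> Polynomial.coeff (v $ x) m \<noteq> 0}" for m
  have wt: "wt m = card {x. x < n \<and> cv m $ x \<noteq> 0}" for m
    unfolding wt_def cv_def by (rule arg_cong[of _ _ card]) auto
  have cvc: "cv m \<in> carrier_vec n" for m by (simp add: cv_def)
  have Mcv: "(M *\<^sub>v cv m) $ i = Polynomial.coeff (syndrome v i) m" if "i < n" for m i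
    using that M by (simp add: cv_def scalar_prod_def atLeast0LessThan syndrome_def coeff_sum)
  have cv0: "Polynomial.coeff (syndrome v i) m = 0" if "cv m = 0\<^sub>v n" "i < n" for m i
    using that M by (simp flip: Mcv)
  define S where "S = {m. cv m \<noteq> 0\<^sub>v n}"
  have "S \<subseteq> (\<Union>x<n. {..Polynomial.degree (v $ x)})"
    by (auto simp: S_def cv_def vec_eq_iff intro: Polynomial.le_degree)
  hence fin: "finite S" by (rule finite_subset) auto
  obtain x where x: "x < n" "v $ x \<noteq> 0" using v dim by (auto simp: vec_eq_iff)
  hence "cv (Polynomial.degree (v $ x)) $ x \<noteq> 0" by (simp add: cv_def)
  hence "cv (Polynomial.degree (v $ x)) \<noteq> 0\<^sub>v n" using x(1) by auto
  hence "S \<noteq> {}" by (auto simp: S_def)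
  define a b where "a = Min S" and "b = Max S"
  have ab: "cv a \<noteq> 0\<^sub>v n" "cv b \<noteq> 0\<^sub>v n"
    using Min_in[OF fin \<open>S \<noteq> {}\<close>] Max_in[OF fin \<open>S \<noteq> {}\<close>] by (auto simp: S_def a_def b_def)
  have low: "cv m = 0\<^sub>v n" if "m < a" for m
    using that Min_le[OF fin, of m] by (force simp: a_def S_def)
  have high: "cv m = 0\<^sub>v n" if "b < m" for m
    using that Max_ge[OF fin, of m] by (force simp: b_def S_def)
  \<comment> \<open>Check \<open>f s\<close> at \<open>a\<close> is the coefficient of
    \<open>u s\<close> one step lower, that is, check \<open>g s\<close> on a zero vector; for
    \<open>a = 0\<close> it vanishes through the factor \<open>D\<close>. The remaining checks
    vanish on the whole code.\<close>
  have synA: "(M *\<^sub>v cv a) $ i = 0" if i: "i \<in> {..<n} - g ` {..<k}" for i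
  proof (cases "i \<in> f ` {..<\<mu>}")
    case True
    then obtain s where s: "s < \<mu>" "i = f s" by auto
    hence sk: "s < k" using \<mu>_le by simp
    have "Polynomial.coeff (syndrome v (g s)) m = 0" if "Suc m = a" for m
      using that low g_lt[OF sk] by (intro cv0) auto
    thus ?thesis
      using i s by (simp add: Mcv u syndrome_f syndrome_g[OF sk] coeff_pCons split: nat.splits)
  next
    case False
    with i show ?thesis by (simp add: Mcv u syndrome_other)
  qed
  \<comment> \<open>Check \<open>g s\<close> at \<open>b\<close> equals check \<open>f s\<close> at
    \<open>Suc b\<close>, beyond the last nonzero coefficient vector.\<close>
  have synB: "(M *\<^sub>v cv b) $ i = 0" if i: "i \<in> g ` {..<\<mu>}" for i
  proof -
    obtain s where s: "s < \<mu>" "i = g s" using i by auto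
    hence sk: "s < k" using \<mu>_le by simp
    have "Polynomial.coeff (syndrome v (f s)) (Suc b) = 0"
      using high f_lt[OF s(1)] by (intro cv0) auto
    thus ?thesis using s g_lt[OF sk] by (simp add: Mcv u syndrome_f syndrome_g[OF sk])
  qed
  show ?thesis
  proof (cases "a = b")
    case True
    have "d \<le> wt a"
      unfolding wt using synA synB ab True by (intro AB cvc) auto
    also have "\<dots> \<le> weight v"
      using sum_card_coeff_le_weight[of "{a}" v] by (simp add: dim wt_def)
    finally show ?thesis .
  next
    case False
    have "d \<le> wt a + wt b"
      using d A[OF cvc ab(1) synA] B[OF cvc ab(2) synB] by (simp add: wt)
    also have "\<dots> \<le> weight v"
      using sum_card_coeff_le_weight[of "{a, b}" v] False by (simp add: dim wt_def)
    finally show ?thesis .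
  qed
qed

lemma free_distance_ge:
  assumes "\<And>v. v \<in> code_of G \<Longrightarrow> v \<noteq> 0\<^sub>v n \<Longrightarrow> d \<le> weight v"
  shows "d \<le> free_distance n (code_of G)"
proof -
  \<comment> \<open>\<open>Inf\<close> of the empty set of naturals is 0, so a nonzero codeword has
    to be exhibited first.\<close>
  have "encode G (\<lambda>_. 1) \<noteq> 0\<^sub>v n"
  proof
    assume eq: "encode G (\<lambda>_. 1) = 0\<^sub>v n"
    have "syndrome (encode G (\<lambda>_. 1)) (g 0) = 1"
      using \<mu>_pos \<mu>_le by (intro syndrome_g) auto
    thus False by (simp add: eq syndrome_def)
  qed
  hence "code_of G - {0\<^sub>v n} \<noteq> {}" by (auto simp: code_of_eq_range_encode)
  thus ?thesis
    unfolding free_distance_def using assms by (intro cInf_greatest) auto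
qed

lemma convolutional_code_G:
  "convolutional_code n k \<mu> 1 (free_distance n (code_of G)) (code_of G)"
  unfolding convolutional_code_def reduced_basic_generator_matrix_def
  using G_carrier basic_G overall_constraint_length_G memory_G overall_constraint_length_minimal
  by (auto intro!: bexI[of _ G] simp: basic_generator_matrix_def)

end

section \<open>The code of length \<open>q\<^sup>2 - 1\<close>\<close>

text \<open>Multiplication by \<open>q\<close> modulo \<open>q\<^sup>2 - 1\<close> swaps the two
  base-\<open>q\<close> digits of an index. \<open>I\<close> collects the indices with a digit 0
  together with \<open>q + 1\<close>, whose digits are both 1; \<open>J\<close> collects those with
  one digit 1 and the other at least 2.\<close>

lemma bch_index_sets:
  fixes q n :: nat
  assumes q: "q \<ge> 3" and n: "n = q\<^sup>2 - 1"
  obtains I J where "I \<subseteq> {..<n}" "J \<subseteq> {..<n}" "I \<inter> J = {}"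
    "card I = 2 * q" "card J = 2 * q - 4"
    "\<And>i. i \<in> I \<Longrightarrow> i * q mod n \<in> I" "\<And>i. i \<in> J \<Longrightarrow> i * q mod n \<in> J"
    "{..<q + 2} \<subseteq> I" "{q + 2..<2 * q} \<subseteq> J"
proof -
  have n': "q * q = Suc n" using n q by (simp add: power2_eq_square)
  define I where "I = {..q} \<union> (\<lambda>j. q * j) ` {2..<q} \<union> {Suc q}"
  define J where "J = (\<lambda>j. q + j) ` {2..<q} \<union> (\<lambda>j. Suc (q * j)) ` {2..<q}"
  have bound: "q * j + q \<le> Suc n" if "j < q" for j
  proof -
    have "q * Suc j \<le> q * q" using that by (intro mult_le_mono2) simp
    thus ?thesis by (simp add: n')
  qed
  have q2: "q * j \<ge> q + q" if "2 \<le> j" for j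
    using mult_le_mono2[OF that, of q] by linarith
  have nlarge: "q + q < n" using bound[of 2] q by simp
  have lt: "Suc (q * j) < n" if "j < q" for j using bound[OF that] q by simp
  have mod_q: "Suc (q * j) mod q = 1" "(q * j) mod q = 0" for j
    using q mod_mult_self2[of 1 q j] by simp_all
  have big: "(n + m) mod n = m" if "m < n" for m using that by simp
  show ?thesis
  proof
    show "I \<subseteq> {..<n}"
      using nlarge lt q by (auto simp: I_def intro: Suc_lessD)
    show "J \<subseteq> {..<n}"
      using nlarge lt by (auto simp: J_def)
    show "I \<inter> J = {}"
    proof -
      have neq1: "q * j \<noteq> q + j'" if "j' \<in> {2..<q}" for j j'
      proof
        assume "q * j = q + j'"
        hence "(q * j) mod q = (q + j') mod q" by (rule arg_cong)
        with that show False by simp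
      qed
      have neq2: "q * j \<noteq> Suc (q * j')" for j j'
        using mod_q(1)[of j'] mod_q(2)[of j] by (metis zero_neq_one)
      have ge: "q + 2 \<le> i" if "i \<in> J" for i
        using that q by (auto simp: J_def dest!: q2)
      have "i \<notin> J" if iI: "i \<in> I" for i
      proof -
        consider "i \<le> Suc q" | j where "i = q * j" using iI by (auto simp: I_def)
        thus ?thesis
        proof cases
          case 1
          with ge[of i] show ?thesis by auto
        next
          case 2
          show ?thesis
          proof
            assume "i \<in> J"
            then consider j' where "i = q + j'" "j' \<in> {2..<q}" | j' where "i = Suc (q * j')"
              unfolding J_def by blast
            thus False using 2 neq1 neq2 by cases metis+
          qed
        qed
      qed
      thus ?thesis by blast
    qed
    have inj: "inj_on (\<lambda>j. q * j) {2..<q}" "inj_on (\<lambda>j. Suc (q * j)) {2..<q}"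
      using q by (auto simp: inj_on_def)
    have "card I = card {..Suc q} + card ((\<lambda>j. q * j) ` {2..<q})"
    proof -
      have "I = {..Suc q} \<union> (\<lambda>j. q * j) ` {2..<q}" by (auto simp: I_def)
      moreover have "{..Suc q} \<inter> (\<lambda>j. q * j) ` {2..<q} = {}" using q2 q by fastforce
      ultimately show ?thesis by (simp add: card_Un_disjoint)
    qed
    thus "card I = 2 * q" using inj(1) q by (simp add: card_image)
    have "card J = card ((\<lambda>j. q + j) ` {2..<q}) + card ((\<lambda>j. Suc (q * j)) ` {2..<q})"
      unfolding J_def
    proof (rule card_Un_disjoint)
      show "(\<lambda>j. q + j) ` {2..<q} \<inter> (\<lambda>j. Suc (q * j)) ` {2..<q} = {}"
        using q2 by fastforce
    qed auto
    thus "card J = 2 * q - 4" using inj(2) by (simp add: card_image)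
    show "i * q mod n \<in> I" if "i \<in> I" for i
    proof -
      consider "i = 0" | "i = 1" | "i = q" | "2 \<le> i" "i < q" | j where "i = q * j" "2 \<le> j" "j < q" | "i = Suc q"
        using \<open>i \<in> I\<close> by (force simp: I_def)
      thus ?thesis
      proof cases
        case 4
        with lt[of i] have "i * q mod n = q * i" by (simp add: mult.commute)
        with 4 show ?thesis by (auto simp: I_def)
      next
        case 5
        have "i * q = j * (q * q)" using 5 by simp
        also have "\<dots> = j * n + j" unfolding n' by simp
        finally show ?thesis using 5 nlarge by (simp add: I_def)
      next
        case 6
        have "i * q = q + (q * q)" using 6 by simp
        also have "\<dots> = n + Suc q" unfolding n' by simp
        finally show ?thesis using big[of "Suc q"] nlarge q by (simp add: I_def)
      next
        case 3
        thus ?thesis using big[of 1] nlarge q by (simp add: I_def n')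
      qed (use nlarge in \<open>auto simp: I_def\<close>)
    qed
    show "i * q mod n \<in> J" if "i \<in> J" for i
    proof -
      consider j where "i = q + j" "j \<in> {2..<q}" | j where "i = Suc (q * j)" "j \<in> {2..<q}"
        using \<open>i \<in> J\<close> unfolding J_def by blast
      thus ?thesis
      proof cases
        case 1
        have "i * q = q * q + q * j" using 1 by (simp add: algebra_simps)
        also have "\<dots> = n + Suc (q * j)" unfolding n' by simp
        finally have "i * q mod n = Suc (q * j)" using big[OF lt, of j] 1 by simp
        with 1 show ?thesis by (auto simp: J_def)
      next
        case 2
        have "i * q = j * (q * q) + q" using 2 by (simp add: algebra_simps)
        also have "\<dots> = j * n + (q + j)" unfolding n' by simp
        finally have "i * q mod n = (q + j) mod n" by (simp only: mod_mult_self3)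
        also have "\<dots> = q + j" using 2(2) nlarge by (intro mod_less) simp
        finally have "i * q mod n = q + j" .
        with 2 show ?thesis by (auto simp: J_def)
      qed
    qed
    show "{..<q + 2} \<subseteq> I" by (auto simp: I_def)
    show "{q + 2..<2 * q} \<subseteq> J"
    proof
      fix i assume "i \<in> {q + 2..<2 * q}"
      hence "i = q + (i - q)" "i - q \<in> {2..<q}" by auto
      thus "i \<in> J" unfolding J_def by blast
    qed
  qed
qed

lemma exists_right_inverse_mat:
  fixes M :: "'a::field mat"
  assumes M: "M \<in> carrier_mat n n"
    and inj: "\<And>z. z \<in> carrier_vec n \<Longrightarrow> M *\<^sub>v z = 0\<^sub>v n \<Longrightarrow> z = 0\<^sub>v n"
  obtains N where "N \<in> carrier_mat n n" "M * N = 1\<^sub>m n"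
proof -
  have "det M \<noteq> 0" using inj det_0_iff_vec_prod_zero_field[OF M] by auto
  from det_non_zero_imp_unit[OF M this, of "()"] show ?thesis
    using that by (auto simp: Units_def ring_mat_def)
qed

theorem theorem5p3:
  fixes q n :: nat
  assumes "primepow q" and "q \<ge> 4"
    and "CARD('a::{field, finite}) = q"
    and "n = q\<^sup>2 - 1"
  shows "\<exists>(C :: 'a poly vec set) d.
           convolutional_code n (n - 2 * q) (2 * q - 4) 1 d C \<and> d \<ge> 2 * q + 1"
proof -
  let ?wt = "\<lambda>z. card {x. x < n \<and> z $ x \<noteq> (0 :: 'a)}"
  define k \<mu> where "k = n - 2 * q" and "\<mu> = 2 * q - 4"
  obtain M :: "'a mat" where M: "M \<in> carrier_mat n n"
    and bch: "\<And>z I l \<delta>. \<lbrakk>z \<in> carrier_vec n; z \<noteq> 0\<^sub>v n; I \<subseteq> {..<n}; {l..<l + \<delta>} \<subseteq> I;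
       \<And>i. i \<in> I \<Longrightarrow> i * q mod n \<in> I; \<And>i. i \<in> I \<Longrightarrow> (M *\<^sub>v z) $ i = 0\<rbrakk> \<Longrightarrow> \<delta> < ?wt z"
    by (rule exists_bch_parity_check_matrix[where 'a = 'a, unfolded assms(3), OF assms(1,4)])
      (erule that, blast)
  obtain N where N: "N \<in> carrier_mat n n" "M * N = 1\<^sub>m n"
  proof (rule exists_right_inverse_mat[OF M])
    fix z assume z: "z \<in> carrier_vec n" "M *\<^sub>v z = 0\<^sub>v n"
    show "z = 0\<^sub>v n"
    proof (rule ccontr)
      assume "z \<noteq> 0\<^sub>v n"
      \<comment> \<open>All \<open>n\<close> exponents are consecutive, so a nonzero kernel vector
        would have weight above its length.\<close>
      hence "n < ?wt z" using z by (intro bch[of z "{..<n}" 0]) auto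
      moreover have "?wt z \<le> card {..<n}" by (intro card_mono) auto
      ultimately show False by simp
    qed
  qed
  obtain I J where I: "I \<subseteq> {..<n}" "card I = 2 * q" "\<And>i. i \<in> I \<Longrightarrow> i * q mod n \<in> I" "{..<q + 2} \<subseteq> I"
    and J: "J \<subseteq> {..<n}" "card J = \<mu>" "\<And>i. i \<in> J \<Longrightarrow> i * q mod n \<in> J" "{q + 2..<2 * q} \<subseteq> J"
    and IJ: "I \<inter> J = {}"
  proof (rule bch_index_sets[of q n])
    show "q \<ge> 3" using assms(2) by simp
  qed (use that assms(4) in \<open>simp_all add: \<mu>_def\<close>)
  have fin: "finite I" "finite J" using I(1) J(1) finite_subset by auto
  \<comment> \<open>Disjointness inside \<open>{..<n}\<close> gives
    \<open>2 * q + \<mu> \<le> n\<close>; hence \<open>\<mu> \<le> k\<close>, and the subtraction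
    defining \<open>k\<close> is not truncated.\<close>
  have "card (I \<union> J) = 2 * q + \<mu>" using fin IJ I(2) J(2) by (simp add: card_Un_disjoint)
  moreover have "card (I \<union> J) \<le> n" using card_mono[of "{..<n}" "I \<union> J"] I(1) J(1) by simp
  ultimately have \<mu>k: "\<mu> \<le> k" and cardR: "card ({..<n} - (I \<union> J)) = k - \<mu>"
    using I(1) J(1) fin by (auto simp: k_def card_Diff_subset)
  obtain h1 where h1: "bij_betw h1 {..<\<mu>} J"
    using J(2) fin(2) by (metis bij_betw_iff_card card_lessThan finite_lessThan)
  obtain h2 where h2: "bij_betw h2 {\<mu>..<k} ({..<n} - (I \<union> J))"
    using cardR by (metis bij_betw_iff_card card_atLeastLessThan finite_atLeastLessThan finite_Diff finite_lessThan)
  obtain f where f: "inj_on f {..<\<mu>}" "f ` {..<\<mu>} \<subseteq> I"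
    using card_le_inj[of "{..<\<mu>}" I] fin(1) I(2) by (auto simp: \<mu>_def)
  \<comment> \<open>\<open>J\<close> is enumerated first, so that the rows with a \<open>D\<close>
    term are exactly those indexed by \<open>J\<close>.\<close>
  define g where "g r = (if r < \<mu> then h1 r else h2 r)" for r
  have gJ: "g ` {..<\<mu>} = J" using h1 by (auto simp: g_def bij_betw_def)
  have "bij_betw g ({..<\<mu>} \<union> {\<mu>..<k}) (J \<union> ({..<n} - (I \<union> J)))"
  proof (rule bij_betw_combine)
    show "bij_betw g {..<\<mu>} J" using h1 by (rule bij_betw_cong[THEN iffD1, rotated]) (simp add: g_def)
    show "bij_betw g {\<mu>..<k} ({..<n} - (I \<union> J))"
      using h2 by (rule bij_betw_cong[THEN iffD1, rotated]) (simp add: g_def)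
  qed auto
  moreover have "{..<\<mu>} \<union> {\<mu>..<k} = {..<k}" using \<mu>k by auto
  moreover have "J \<union> ({..<n} - (I \<union> J)) = {..<n} - I" using J(1) IJ by auto
  ultimately have g: "bij_betw g {..<k} ({..<n} - I)" by simp
  hence gI: "{..<n} - g ` {..<k} = I" using I(1) by (auto simp: bij_betw_def)
  interpret unit_memory_code n k \<mu> M N f g
  proof
    show "inj_on g {..<k}" using g by (simp add: bij_betw_def)
    show "g r < n" if "r < k" for r using g that by (auto simp: bij_betw_def)
    show "f r < n" if "r < \<mu>" for r using f(2) I(1) that by auto
    show "f r \<noteq> g s" if "r < \<mu>" "s < k" for r s using f(2) g that by (auto simp: bij_betw_def)
    show "0 < \<mu>" using assms(2) by (simp add: \<mu>_def)
  qed (use M N f \<mu>k in auto)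
  have "2 * q + 1 \<le> weight v" if v: "v \<in> code_of G" "v \<noteq> 0\<^sub>v n" for v
  \<comment> \<open>There are \<open>q + 2\<close> consecutive exponents in \<open>I\<close>,
    \<open>q - 2\<close> in \<open>J\<close> and \<open>2 * q\<close> in the union. The BCH bound
    adds 1 to each, so two distinct coefficient vectors have total weight at least
    \<open>2 * q + 2\<close> and a single one at least \<open>2 * q + 1\<close>.\<close>
  proof (rule weight_code_ge[OF v, where dA = "q + 3" and dB = "q - 1"], unfold gI gJ)
    fix z :: "'a vec"
    assume z: "z \<in> carrier_vec n" "z \<noteq> 0\<^sub>v n"
    show "q + 3 \<le> ?wt z" if "\<And>i. i \<in> I \<Longrightarrow> (M *\<^sub>v z) $ i = 0"
      using bch[OF z, of I 0 "q + 2"] I that by (simp add: atLeast0LessThan)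
    show "q - 1 \<le> ?wt z" if "\<And>i. i \<in> J \<Longrightarrow> (M *\<^sub>v z) $ i = 0"
    proof -
      have "q + 2 + (q - 2) = 2 * q" using assms(2) by simp
      with J(4) have "{q + 2..<q + 2 + (q - 2)} \<subseteq> J" by (simp only:)
      hence "q - 2 < ?wt z" by (rule bch[OF z J(1) _ J(3) that])
      thus ?thesis by simp
    qed
    show "2 * q + 1 \<le> ?wt z" if "\<And>i. i \<in> I \<union> J \<Longrightarrow> (M *\<^sub>v z) $ i = 0"
    proof -
      have "{0..<0 + 2 * q} \<subseteq> I \<union> J"
      proof
        fix i assume "i \<in> {0..<0 + 2 * q}"
        hence "i \<in> {..<q + 2} \<or> i \<in> {q + 2..<2 * q}" by auto
        thus "i \<in> I \<union> J" using I(4) J(4) by blast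
      qed
      hence "2 * q < ?wt z" using I J that by (intro bch[OF z, of "I \<union> J" 0]) auto
      thus ?thesis by simp
    qed
  qed (use assms(2) in simp)
  hence "2 * q + 1 \<le> free_distance n (code_of G)" by (rule free_distance_ge)
  with convolutional_code_G show ?thesis unfolding k_def \<mu>_def by blast
qed

end
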